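(* The constant functions $0,1:\mathbf{R}\rightarrow\mathbf{B}$ are signals. If $0\leq m\leq d$ and $x,y\in S$, then the functions $x\circ\tau^{d}$, $\overline{x(t)}$, $x(t)\cdot y(t)$, $x(t)\cup y(t)$, $x(t)\oplus y(t)$, $\bigcap_{\xi\in[t-d,t-d+m]}x(\xi)$ and $\bigcup_{\xi\in[t-d,t-d+m]}x(\xi)$ (as functions of $t\in\mathbf{R}$) are signals too.
   Context: $\mathbf{B}=\{0,1\}$ carries the discrete topology, the order $0\leq 1$ and the usual Boolean laws: complement $\overline{\,\cdot\,}$, product (AND) $\cdot$, union (OR) $\cup$, and exclusive or $\oplus$; these laws are extended pointwise to functions $\mathbf{R}\rightarrow\mathbf{B}$. For $x:\mathbf{R}\rightarrow\mathbf{B}$ and $A\subset\mathbf{R}$, $\bigcap_{\xi\in A}x(\xi)$ equals $0$ if there exists $\xi\in A$ with $x(\xi)=0$ and $1$ otherwise (so it is $1$ for $A=\emptyset$); $\bigcup_{\xi\in A}x(\xi)$ equals $1$ if there exists $\xi\in A$ with $x(\xi)=1$ and $0$ otherwise. For $A\subset\mathbf{R}$, $\chi_A$ is the characteristic function of $A$ with values in $\mathbf{B}$. A signal is a function $x:\mathbf{R}\rightarrow\mathbf{B}$ for which there exists an unbounded sequence $0\leq t_0<t_1<t_2<\dots$ of reals with $x(t)=x(t_0-1)\cdot\chi_{(-\infty,t_0)}(t)\oplus x(t_0)\cdot\chi_{[t_0,t_1)}(t)\oplus x(t_1)\cdot\chi_{[t_1,t_2)}(t)\oplus\cdots$ for all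 $t$. $S$ denotes the set of signals. For $d\in\mathbf{R}$, $\tau^d:\mathbf{R}\rightarrow\mathbf{R}$ is the translation $\tau^d(t)=t-d$. *)

theory Defs
  imports Complex_Main
begin

text \<open>
  The Boolean algebra B is the type \<^typ>\<open>bool\<close>: 0 is \<^term>\<open>False\<close>, 1 is \<^term>\<open>True\<close>,
  and the value at \<open>s\<close> of the characteristic function of a set \<open>A\<close> is \<open>s \<in> A\<close>.
  The intersection and union of a function over a set are \<open>INF\<close> and \<open>SUP\<close> in the complete
  lattice \<^typ>\<open>bool\<close>; in particular the intersection over the empty set is \<^term>\<open>True\<close>.
\<close>

definition bxor :: "bool \<Rightarrow> bool \<Rightarrow> bool"  (infixl \<open>\<oplus>\<close> 37)
  where "a \<oplus> b \<longleftrightarrow> a \<noteq> b"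

text \<open>
  Exclusive or of a sequence with finitely many true terms: the parity of their number.
  (In the definition of a signal at most one term is true at each time. The value
  \<^term>\<open>False\<close> for an infinite family is an irrelevant default.)
\<close>

definition Bxor :: "(nat \<Rightarrow> bool) \<Rightarrow> bool"
  where "Bxor f \<longleftrightarrow> odd (card {k. f k})"

lemma Bxor_Suc:
  assumes "finite {k. f k}"
  shows "Bxor f \<longleftrightarrow> f 0 \<oplus> Bxor (\<lambda>k. f (Suc k))"
proof -
  let ?A = "{k. f (Suc k)}"
  have eq: "{k. f k} = (if f 0 then {0} else {}) \<union> Suc ` ?A"
    by (auto simp: image_iff split: if_splits) (metis not0_implies_Suc)+
  have fin: "finite (Suc ` ?A)"
    using assms by (rule finite_subset[rotated]) auto
  have "card {k. f k} = (if f 0 then 1 else 0) + card (Suc ` ?A)"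
    using fin by (subst eq) auto
  then show ?thesis
    by (simp add: Bxor_def bxor_def card_image)
qed

lemma Bxor_False: "\<not> Bxor (\<lambda>_. False)"
  by (simp add: Bxor_def)

definition signals :: "(real \<Rightarrow> bool) set"
  where "signals = {x. \<exists>t :: nat \<Rightarrow> real.
     0 \<le> t 0 \<and> strict_mono t \<and> \<not> bdd_above (range t) \<and>
     (\<forall>s. x s \<longleftrightarrow> (x (t 0 - 1) \<and> s \<in> {..<t 0})
            \<oplus> Bxor (\<lambda>k. x (t k) \<and> s \<in> {t k..<t (Suc k)}))}"

definition shift :: "real \<Rightarrow> real \<Rightarrow> real"  (\<open>\<tau>\<close>)
  where "\<tau> d t = t - d"

end

theory Submission
  imports Defs
begin

text \<open>
  A function is a signal iff there is a locally finite set of nonnegative reals such that the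
  function takes the same value at \<open>s\<close> and \<open>u\<close> whenever no point of the set lies in \<open>(s, u]\<close>.
  In this form the closure properties are immediate: take the union of the two sets for a binary
  operation, and the translates by \<open>d\<close> and \<open>d - m\<close> for the windows, because the values attained
  on the window can only change when one of its end points passes a point of the set.
\<close>

definition jumps_within :: "real set \<Rightarrow> (real \<Rightarrow> bool) \<Rightarrow> bool"
  where "jumps_within F x \<longleftrightarrow> F \<subseteq> {0..} \<and> (\<forall>b. finite (F \<inter> {..b})) \<and>
     (\<forall>s u. s \<le> u \<longrightarrow> F \<inter> {s<..u} = {} \<longrightarrow> x s = x u)"

lemma jumps_withinI:
  assumes "F \<subseteq> {0..}" "\<And>b. finite (F \<inter> {..b})"
    and "\<And>s u. s \<le> u \<Longrightarrow> F \<inter> {s<..u} = {} \<Longrightarrow> x s = x u"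
  shows "jumps_within F x"
  using assms by (auto simp: jumps_within_def)

lemma jumps_withinD:
  assumes "jumps_within F x"
  shows "F \<subseteq> {0..}" "finite (F \<inter> {..b})"
    and "s \<le> u \<Longrightarrow> F \<inter> {s<..u} = {} \<Longrightarrow> x s = x u"
  using assms by (auto simp: jumps_within_def)

section \<open>Evaluating the expansion that defines a signal\<close>

lemma unbounded_steps_cases:
  fixes t :: "nat \<Rightarrow> real"
  assumes "\<not> bdd_above (range t)"
  obtains "s < t 0" | k where "s \<in> {t k..<t (Suc k)}"
proof -
  obtain n where n: "s < t n"
    using assms by (force simp: bdd_above_def not_le)
  \<comment> \<open>The least index is what places \<open>s\<close>: either it is 0, or its
    predecessor \<open>k\<close> satisfies \<open>t k \<le> s < t (Suc k)\<close>.\<close>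
  define N where "N = (LEAST n. s < t n)"
  have N: "s < t N" "\<And>j. j < N \<Longrightarrow> t j \<le> s"
    unfolding N_def using n by (auto intro: LeastI dest: not_less_Least)
  show thesis
  proof (cases N)
    case 0
    then show thesis using N that(1) by simp
  next
    case (Suc k)
    then show thesis using N that(2)[of k] by auto
  qed
qed

lemma strict_mono_step_unique:
  fixes t :: "nat \<Rightarrow> real"
  assumes "strict_mono t" "s \<in> {t k..<t (Suc k)}" "s \<in> {t j..<t (Suc j)}"
  shows "j = k"
proof -
  have "t j < t (Suc k)" "t k < t (Suc j)"
    using assms by auto
  then have "j < Suc k" "k < Suc j"
    using strict_mono_less[OF assms(1)] by blast+
  then show ?thesis by simp
qed

text \<open>Since \<open>s\<close> precedes every \<open>t k\<close>, all terms of the parity sum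
  vanish and only the initial term survives.\<close>

lemma step_expansion_before:
  fixes t :: "nat \<Rightarrow> real"
  assumes "strict_mono t" "s < t 0"
  shows "((c \<and> s \<in> {..<t 0}) \<oplus> Bxor (\<lambda>k. x (t k) \<and> s \<in> {t k..<t (Suc k)})) \<longleftrightarrow> c"
proof -
  have "t 0 \<le> t k" for k
    using assms(1) by (simp add: strict_mono_less_eq)
  then have "s < t k" for k
    using assms(2) by (meson less_le_trans)
  then have "(\<lambda>k. x (t k) \<and> s \<in> {t k..<t (Suc k)}) = (\<lambda>_. False)"
    by (auto simp: fun_eq_iff not_le)
  then show ?thesis
    using assms(2) by (simp add: Bxor_False bxor_def)
qed

text \<open>The half-open intervals are disjoint, so the parity counts at most the single index
  \<open>k\<close>, and it counts it exactly when \<open>x (t k)\<close> holds. The initial term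
  vanishes because \<open>t 0 \<le> t k \<le> s\<close>.\<close>

lemma step_expansion_at:
  fixes t :: "nat \<Rightarrow> real"
  assumes "strict_mono t" "s \<in> {t k..<t (Suc k)}"
  shows "((c \<and> s \<in> {..<t 0}) \<oplus> Bxor (\<lambda>k. x (t k) \<and> s \<in> {t k..<t (Suc k)})) \<longleftrightarrow> x (t k)"
proof -
  have "t 0 \<le> t k"
    using assms(1) by (simp add: strict_mono_less_eq)
  moreover have "s \<in> {t j..<t (Suc j)} \<longleftrightarrow> j = k" for j
    using assms(2) strict_mono_step_unique[OF assms] by blast
  then have "{j. x (t j) \<and> s \<in> {t j..<t (Suc j)}} = (if x (t k) then {k} else {})"
    by (simp only:) auto
  ultimately show ?thesis
    using assms(2) by (simp add: Bxor_def bxor_def)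
qed

section \<open>Signals and locally finite jump sets\<close>

lemma signals_imp_jumps_within:
  assumes "x \<in> signals"
  obtains F where "jumps_within F x"
proof -
  obtain t :: "nat \<Rightarrow> real" where t0: "0 \<le> t 0" and mono: "strict_mono t"
    and unb: "\<not> bdd_above (range t)"
    and x: "\<And>s. x s \<longleftrightarrow> (x (t 0 - 1) \<and> s \<in> {..<t 0})
            \<oplus> Bxor (\<lambda>k. x (t k) \<and> s \<in> {t k..<t (Suc k)})"
    using assms unfolding signals_def by (elim CollectE exE conjE) (rule that; (assumption | erule spec))
  have before: "x s = x (t 0 - 1)" if "s < t 0" for s
    using x[of s] step_expansion_before[OF mono that] by blast
  have step: "x s = x (t k)" if "s \<in> {t k..<t (Suc k)}" for s k
    using x[of s] step_expansion_at[OF mono that] by blast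
  have "jumps_within (range t) x"
  proof (rule jumps_withinI)
    have "0 \<le> t k" for k
      using t0 strict_mono_less_eq[OF mono, of 0 k] by simp
    then show "range t \<subseteq> {0..}" by auto
  next
    fix b
    \<comment> \<open>By monotonicity only the first \<open>n\<close> terms can be at most
      \<open>b\<close>; this is local finiteness.\<close>
    obtain n where "b < t n"
      using unb by (force simp: bdd_above_def not_le)
    then have "k < n" if "t k \<le> b" for k
      using that strict_mono_less[OF mono, of k n] by simp
    then have "range t \<inter> {..b} \<subseteq> t ` {..<n}" by auto
    then show "finite (range t \<inter> {..b})"
      by (rule finite_subset) simp
  next
    fix s u :: real
    assume su: "s \<le> u" "range t \<inter> {s<..u} = {}"
    from unb show "x s = x u"
    proof (cases rule: unbounded_steps_cases[of t u])
      case 1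
      then show ?thesis using before[of s] before[of u] su by simp
    next
      case (2 k)
      \<comment> \<open>Otherwise \<open>t k\<close> itself would lie in \<open>(s, u]\<close>,
        against the assumption on \<open>range t\<close>.\<close>
      then have "t k \<le> s" using su by force
      then show ?thesis using step[of s k] step[of u k] 2 su by simp
    qed
  qed
  then show thesis by (rule that)
qed

text \<open>An unbounded, locally finite set of reals can be enumerated increasingly. The
  enumeration serves as the switching sequence, since \<open>x\<close> is constant from each of its
  points up to the next.\<close>

lemma jumps_within_imp_signals:
  assumes "jumps_within F x"
  shows "x \<in> signals"
proof -
  text \<open>The natural numbers are added because \<open>F\<close> may be finite.\<close>
  define G where "G = F \<union> range real"
  have G0: "G \<subseteq> {0..}"
    using jumps_withinD(1)[OF assms] by (auto simp: G_def)
  have "0 \<in> G"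
    unfolding G_def using rangeI[of real 0] by simp
  have fin: "finite (G \<inter> {..b})" for b
  proof -
    have "range real \<inter> {..b} \<subseteq> real ` {..nat \<lfloor>b\<rfloor>}"
      by (auto simp: le_nat_floor)
    then have "finite (range real \<inter> {..b})"
      by (rule finite_subset) simp
    then show ?thesis
      using jumps_withinD(2)[OF assms] by (simp add: G_def Int_Un_distrib2)
  qed
  have const: "x s = x u" if "s \<le> u" "G \<inter> {s<..u} = {}" for s u
    using jumps_withinD(3)[OF assms, of s u] that by (auto simp: G_def)
  have "\<exists>b. b \<in> G \<and> a < b \<and> G \<inter> {a<..<b} = {}" for a
  proof -
    obtain n where n: "a < real n" using reals_Archimedean2 by blast
    \<comment> \<open>Cutting off at a natural number beyond \<open>a\<close> makes the set finite
      by local finiteness and nonempty because \<open>real n\<close> lies in \<open>G\<close>. Its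
      minimum is the successor of \<open>a\<close> in \<open>G\<close>.\<close>
    define A where "A = G \<inter> {a<..real n}"
    have "finite A"
      by (rule finite_subset[OF _ fin[of "real n"]]) (auto simp: A_def)
    moreover have "real n \<in> A" using n by (simp add: A_def G_def)
    ultimately have A: "finite A" "A \<noteq> {}" by auto
    then have m: "Min A \<in> A" by simp
    have "G \<inter> {a<..<Min A} = {}"
    proof (rule equals0I)
      fix g
      assume g: "g \<in> G \<inter> {a<..<Min A}"
      then have "g \<in> A" using m by (auto simp: A_def)
      then have "Min A \<le> g" using A by simp
      with g show False by simp
    qed
    then show ?thesis using m by (auto simp: A_def)
  qed
  then have next_point: "\<exists>b. b \<in> G \<and> (a < b \<and> G \<inter> {a<..<b} = {})" for a
    by blast
  \<comment> \<open>Iterate the successor; the clause for \<open>n = 0\<close> pins the start to 0,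
    the least point of \<open>G\<close>.\<close>
  have "\<exists>t. \<forall>n. (t n \<in> G \<and> (n = 0 \<longrightarrow> t n = 0)) \<and>
      (t n < t (Suc n) \<and> G \<inter> {t n<..<t (Suc n)} = {})"
    by (rule dependent_nat_choice) (use \<open>0 \<in> G\<close> next_point in auto)
  then obtain t where tG: "\<And>n. t n \<in> G" and t0: "t 0 = 0"
    and less: "\<And>n. t n < t (Suc n)" and gap: "\<And>n. G \<inter> {t n<..<t (Suc n)} = {}"
    by blast
  have mono: "strict_mono t"
    using less by (simp add: strict_mono_Suc_iff)
  have unb: "\<not> bdd_above (range t)"
  \<comment> \<open>A bounded range would be an infinite subset of some finite
    \<open>G \<inter> {..b}\<close>.\<close>
  proof
    assume "bdd_above (range t)"
    then obtain b where "range t \<subseteq> {..b}" by (auto simp: bdd_above_def)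
    then have "range t \<subseteq> G \<inter> {..b}" using tG by auto
    then have "finite (range t)" using fin finite_subset by blast
    then show False
      using strict_mono_imp_inj_on[OF mono] finite_imageD infinite_UNIV_nat by blast
  qed
  have expansion: "x s \<longleftrightarrow> (x (t 0 - 1) \<and> s \<in> {..<t 0})
          \<oplus> Bxor (\<lambda>k. x (t k) \<and> s \<in> {t k..<t (Suc k)})" for s
    using unb
  proof (cases rule: unbounded_steps_cases[of t s])
    case 1
    \<comment> \<open>No point of \<open>G\<close> is negative, so \<open>x\<close> is constant on
      the negative reals, where both \<open>s\<close> and \<open>t 0 - 1\<close> lie.\<close>
    have eq: "x a = x b" if "a \<le> b" "b < 0" for a b
      using that G0 by (intro const) force+
    have "x s = x (t 0 - 1)"
    proof (cases "s \<le> t 0 - 1")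
      case True
      then show ?thesis using t0 by (intro eq) auto
    next
      case False
      then show ?thesis using 1 t0 by (intro eq[symmetric]) auto
    qed
    then show ?thesis using step_expansion_before[OF mono 1] by blast
  next
    case (2 k)
    then have "x (t k) = x s"
      using gap[of k] by (intro const) force+
    then show ?thesis using step_expansion_at[OF mono 2] by blast
  qed
  show ?thesis
    unfolding signals_def
  proof (rule CollectI, rule exI[of _ t], intro conjI allI)
    show "0 \<le> t 0" by (simp add: t0)
    show "strict_mono t" by (rule mono)
    show "\<not> bdd_above (range t)" by (rule unb)
  qed (rule expansion)
qed

section \<open>Closure under Boolean operations, windows and translation\<close>

lemma const_signal: "(\<lambda>_. c) \<in> signals"
  by (rule jumps_within_imp_signals[of "{}"]) (auto simp: jumps_within_def)

lemma signals_binop: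
  assumes "x \<in> signals" "y \<in> signals"
  shows "(\<lambda>t. h (x t) (y t)) \<in> signals"
proof -
  obtain F where F: "jumps_within F x"
    using assms(1) by (rule signals_imp_jumps_within)
  obtain G where G: "jumps_within G y"
    using assms(2) by (rule signals_imp_jumps_within)
  have "jumps_within (F \<union> G) (\<lambda>t. h (x t) (y t))"
  proof (rule jumps_withinI)
    show "F \<union> G \<subseteq> {0..}" using F G by (simp add: jumps_withinD(1))
    show "finite ((F \<union> G) \<inter> {..b})" for b
      using F G by (simp add: jumps_withinD(2) Int_Un_distrib2)
  next
    fix s u :: real
    assume "s \<le> u" "(F \<union> G) \<inter> {s<..u} = {}"
    then have "x s = x u" "y s = y u"
      by (intro jumps_withinD(3)[OF F] jumps_withinD(3)[OF G]; blast)+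
    then show "h (x s) (y s) = h (x u) (y u)" by simp
  qed
  then show ?thesis by (rule jumps_within_imp_signals)
qed

text \<open>Points common to both windows need no argument. A point of the first window left of
  \<open>b\<close> has the value \<open>x b\<close>, and a point of the second beyond
  \<open>a + m\<close> has the value \<open>x (a + m)\<close>, by the two jump-free
  intervals.\<close>

lemma jumps_within_window_image:
  assumes "jumps_within F x" "a \<le> b" "0 \<le> m"
    and "F \<inter> {a<..b} = {}" "F \<inter> {a + m<..b + m} = {}"
  shows "x ` {a..a + m} = x ` {b..b + m}"
proof (intro equalityI image_subsetI)
  fix \<xi>
  assume \<xi>: "\<xi> \<in> {a..a + m}"
  show "x \<xi> \<in> x ` {b..b + m}"
  proof (cases "b \<le> \<xi>")
    case True
    then show ?thesis using \<xi> assms by auto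
  next
    case False
    then have "x \<xi> = x b"
      using \<xi> assms(4) by (intro jumps_withinD(3)[OF assms(1)]) force+
    then show ?thesis using assms by auto
  qed
next
  fix \<xi>
  assume \<xi>: "\<xi> \<in> {b..b + m}"
  show "x \<xi> \<in> x ` {a..a + m}"
  proof (cases "\<xi> \<le> a + m")
    case True
    then show ?thesis using \<xi> assms by auto
  next
    case False
    then have "x (a + m) = x \<xi>"
      using \<xi> assms(5) by (intro jumps_withinD(3)[OF assms(1)]) force+
    then show ?thesis using assms by (auto intro!: image_eqI[of _ _ "a + m"])
  qed
qed

lemma finite_translate_Int_atMost:
  fixes F :: "real set"
  assumes "\<And>b. finite (F \<inter> {..b})"
  shows "finite ((+) c ` F \<inter> {..b})"
proof -
  have "(+) c ` F \<inter> {..b} = (+) c ` (F \<inter> {..b - c})" by auto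
  then show ?thesis using assms by simp
qed

text \<open>Leaving \<open>h\<close> arbitrary treats intersection, union and translation at once:
  each depends only on the set of values attained on the window.\<close>

lemma signals_window:
  assumes "x \<in> signals" "0 \<le> m" "m \<le> d"
  shows "(\<lambda>t. h (x ` {t - d..t - d + m})) \<in> signals"
proof -
  obtain F where F: "jumps_within F x"
    using assms(1) by (rule signals_imp_jumps_within)
  \<comment> \<open>The left end \<open>t - d\<close> meets a point \<open>f\<close> at
    \<open>t = d + f\<close>, the right end at \<open>t = (d - m) + f\<close>.\<close>
  let ?G = "(+) d ` F \<union> (+) (d - m) ` F"
  have "jumps_within ?G (\<lambda>t. h (x ` {t - d..t - d + m}))"
  proof (rule jumps_withinI)
    \<comment> \<open>Both translations are by nonnegative amounts because
      \<open>0 \<le> m \<le> d\<close>.\<close>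
    show "?G \<subseteq> {0..}"
      using jumps_withinD(1)[OF F] assms by force
    show "finite (?G \<inter> {..b})" for b
      using finite_translate_Int_atMost[OF jumps_withinD(2)[OF F]]
      by (simp add: Int_Un_distrib2)
  next
    fix s u :: real
    assume su: "s \<le> u" and no: "?G \<inter> {s<..u} = {}"
    have "F \<inter> {s - d<..u - d} = {}"
    proof (rule equals0I)
      fix f
      assume "f \<in> F \<inter> {s - d<..u - d}"
      then have "d + f \<in> ?G \<inter> {s<..u}" by auto
      with no show False by blast
    qed
    moreover have "F \<inter> {s - d + m<..u - d + m} = {}"
    proof (rule equals0I)
      fix f
      assume "f \<in> F \<inter> {s - d + m<..u - d + m}"
      then have "(d - m) + f \<in> ?G \<inter> {s<..u}" by auto
      with no show False by blast
    qed
    ultimately have "x ` {s - d..s - d + m} = x ` {u - d..u - d + m}"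
      using su assms by (intro jumps_within_window_image[OF F]) auto
    then show "h (x ` {s - d..s - d + m}) = h (x ` {u - d..u - d + m})" by simp
  qed
  then show ?thesis by (rule jumps_within_imp_signals)
qed

lemma signals_shift:
  assumes "x \<in> signals" "0 \<le> d"
  shows "x \<circ> \<tau> d \<in> signals"
proof -
  \<comment> \<open>Translation is the window of length 0: the value set is the singleton of
    \<open>x (t - d)\<close>.\<close>
  have "x \<circ> \<tau> d = (\<lambda>t. True \<in> x ` {t - d..t - d + 0})"
    by (auto simp: fun_eq_iff shift_def)
  then show ?thesis
    using signals_window[OF assms(1), of 0 d "\<lambda>A. True \<in> A"] assms(2) by simp
qed

theorem theorem2p9:
  shows "(\<lambda>t. False) \<in> signals \<and> (\<lambda>t. True) \<in> signals \<and>
    (\<forall>(m::real) (d::real) (x::real \<Rightarrow> bool) (y::real \<Rightarrow> bool).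
       0 \<le> m \<and> m \<le> d \<and> x \<in> signals \<and> y \<in> signals \<longrightarrow>
         x \<circ> \<tau> d \<in> signals \<and>
         (\<lambda>t. \<not> x t) \<in> signals \<and>
         (\<lambda>t. x t \<and> y t) \<in> signals \<and>
         (\<lambda>t. x t \<or> y t) \<in> signals \<and>
         (\<lambda>t. x t \<oplus> y t) \<in> signals \<and>
         (\<lambda>t. INF \<xi>\<in>{t - d..t - d + m}. x \<xi>) \<in> signals \<and>
         (\<lambda>t. SUP \<xi>\<in>{t - d..t - d + m}. x \<xi>) \<in> signals)"
proof (intro conjI allI impI; (elim conjE)?)
  show "(\<lambda>t. False) \<in> signals" "(\<lambda>t. True) \<in> signals"
    by (rule const_signal)+
next
  fix m d :: real and x y :: "real \<Rightarrow> bool"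
  assume md: "0 \<le> m" "m \<le> d" and x: "x \<in> signals" and y: "y \<in> signals"
  show "x \<circ> \<tau> d \<in> signals"
    using x md by (intro signals_shift) auto
  show "(\<lambda>t. \<not> x t) \<in> signals"
    \<comment> \<open>Negation is a binary operation that ignores its second argument.\<close>
    using signals_binop[OF x x, of "\<lambda>a _. \<not> a"] .
  show "(\<lambda>t. x t \<and> y t) \<in> signals" "(\<lambda>t. x t \<or> y t) \<in> signals" "(\<lambda>t. x t \<oplus> y t) \<in> signals"
    by (rule signals_binop[OF x y])+
  show "(\<lambda>t. INF \<xi>\<in>{t - d..t - d + m}. x \<xi>) \<in> signals"
    using signals_window[OF x md, of Inf] .
  show "(\<lambda>t. SUP \<xi>\<in>{t - d..t - d + m}. x \<xi>) \<in> signals"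
    using signals_window[OF x md, of Sup] .
qed

end
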